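(* Assume the nominal edge costs are non-negative. The algorithm LSA described in the context finds an optimal solution of the robust counterpart $$\min_{q\in Q} z^R(q),\qquad z^R(q)=\max_{c\in\mathcal U}\sum_{e\in q}c_e,$$ of the single-objective cardinality-constrained uncertain shortest path problem.
   Context: $G=(V,E)$ is a finite directed graph without parallel edges, $s,t\in V$, and $Q$ is the (nonempty) set of simple paths from $s$ to $t$. Each edge $e$ has a nominal cost $\hat c_e\ge0$ and an interval length $\delta_e\ge0$; $\Gamma$ is an integer with $0\le\Gamma\le|E|$. The uncertainty set is $$\mathcal U=\{c\in\mathbb R^{|E|}: c_e\in[\hat c_e,\hat c_e+\delta_e]\ \forall e\in E,\ |\{e:c_e>\hat c_e\}|\le\Gamma\}.$$ A vector $y^1$ dominates $y^2$ if $y^1_i\le y^2_i$ for all $i$ and $y^1\ne y^2$; a label dominates another if its cost vector does. A label at a node $v$ is a triple $(z,v',l')$ with cost vector $z=(z_0,\dots,z_\Gamma)$, predecessor node $v'$ and predecessor label $l'$ (a label at $v'$); it is temporary or permanent. A label represents the path from $s$ to $v$ obtained by backtracking predecessor labels. For $z'\in\mathbb R^{\Gamma+1}$ and $a,d\ge 0$ define $z=z'\oplus(a,d)$ by $z_0=z'_0+a$ and: if $d\le z'_i$ for all $i=1,\dots,\Gamma$, then $z_i=z'_i$ for all $i\ge1$; otherwise, with $i\ge1$ minimal such that $d>z'_i$, $z_j=z'_j$ for $1\le j<i$, $z_i=d$, $z_j=z'_{j-1}$ for $i<j\le\Gamma$. Algorithm LSA. Step 1 (label setting): create a temporary label with cost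 $(0,\dots,0)$ at $s$. While a temporary label exists: select a temporary label $l'$ (at any node $v'$, with cost $z'$) with minimal aggregate cost $\sum_{i=0}^\Gamma z'_i$ among all temporary labels and make it permanent; then for every outgoing edge $(v',v)$ of $v'$ create a temporary label $l$ at $v$ with cost $z'\oplus(\hat c_{(v',v)},\delta_{(v',v)})$, predecessor node $v'$ and predecessor label $l'$; if the cost of $l$ is dominated by or equal to the cost of another label at $v$, delete $l$; otherwise delete all temporary labels at $v$ dominated by $l$. Step 2: among all permanent labels at $t$ choose one with minimal aggregate cost $\sum_{i=0}^\Gamma z_i$. Step 3: output the path represented by this label. *)

theory Defs
  imports
    Complex_Main
    "HOL-Library.FuncSet"
    "Graph_Theory.Pair_Digraph"
    "Jordan_Normal_Form.Matrix"
begin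

section \<open>The robust shortest path problem\<close>

definition st_paths :: "'v pair_pre_digraph \<Rightarrow> 'v \<Rightarrow> 'v \<Rightarrow> ('v \<times> 'v) list set" where
  "st_paths G s t = {q. pre_digraph.apath (with_proj G) s q t}"

text \<open>Cost vectors indexed by the arcs are extensional functions on \<open>parcs G\<close>.\<close>

definition uncertainty_set ::
    "'v pair_pre_digraph \<Rightarrow> ('v \<times> 'v \<Rightarrow> real) \<Rightarrow> ('v \<times> 'v \<Rightarrow> real) \<Rightarrow> nat \<Rightarrow> ('v \<times> 'v \<Rightarrow> real) set" where
  "uncertainty_set G chat \<delta> \<Gamma> =
     {c \<in> (\<Pi>\<^sub>E e\<in>parcs G. {chat e .. chat e + \<delta> e}). card {e \<in> parcs G. c e > chat e} \<le> \<Gamma>}"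

text \<open>Here \<open>GREATEST\<close> picks the maximum of the set of attained path costs.\<close>

definition robust_cost ::
    "'v pair_pre_digraph \<Rightarrow> ('v \<times> 'v \<Rightarrow> real) \<Rightarrow> ('v \<times> 'v \<Rightarrow> real) \<Rightarrow> nat \<Rightarrow> ('v \<times> 'v) list \<Rightarrow> real" where
  "robust_cost G chat \<delta> \<Gamma> q =
     (GREATEST y. \<exists>c\<in>uncertainty_set G chat \<delta> \<Gamma>. y = (\<Sum>e\<in>set q. c e))"

definition optimal_path ::
    "'v pair_pre_digraph \<Rightarrow> 'v \<Rightarrow> 'v \<Rightarrow> ('v \<times> 'v \<Rightarrow> real) \<Rightarrow> ('v \<times> 'v \<Rightarrow> real) \<Rightarrow> nat \<Rightarrow>
     ('v \<times> 'v) list \<Rightarrow> bool" where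
  "optimal_path G s t chat \<delta> \<Gamma> q \<longleftrightarrow>
     is_arg_min (robust_cost G chat \<delta> \<Gamma>) (\<lambda>q. q \<in> st_paths G s t) q"


section \<open>Labels\<close>

text \<open>The order on vectors of type \<open>real vec\<close> is componentwise.\<close>

definition dominates :: "real vec \<Rightarrow> real vec \<Rightarrow> bool" where
  "dominates y\<^sub>1 y\<^sub>2 \<longleftrightarrow> y\<^sub>1 \<le> y\<^sub>2 \<and> y\<^sub>1 \<noteq> y\<^sub>2"

definition aggregate :: "real vec \<Rightarrow> real" where
  "aggregate z = (\<Sum>i<dim_vec z. z $ i)"

text \<open>
  The update \<open>z \<oplus> (a, d)\<close> of a cost vector \<open>(z\<^sub>0, \<dots>, z\<^sub>\<Gamma>)\<close>, so that \<open>dim_vec z = \<Gamma> + 1\<close>.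
\<close>

definition extend_cost :: "real vec \<Rightarrow> real \<Rightarrow> real \<Rightarrow> real vec" where
  "extend_cost z a d =
     (let I = {1..<dim_vec z}; i = (LEAST i. i \<in> I \<and> d > z $ i) in
      vec (dim_vec z) (\<lambda>j.
        if j = 0 then z $ 0 + a
        else if \<forall>k\<in>I. d \<le> z $ k then z $ j
        else if j < i then z $ j
        else if j = i then d
        else z $ (j - 1)))"

text \<open>
  A label consists of its cost vector and its predecessor node together with the predecessor label;
  only the initial label at \<open>s\<close> has no predecessor. The node at which a label resides is kept
  outside of it: labels at nodes are pairs of type \<open>'v \<times> 'v label\<close>.
\<close>

datatype 'v label = Label (label_cost: "real vec") (label_pred: "('v \<times> 'v label) option")

fun label_path :: "'v \<Rightarrow> 'v label \<Rightarrow> ('v \<times> 'v) list" where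
  "label_path v (Label z None) = []"
| "label_path v (Label z (Some (v', l'))) = label_path v' l' @ [(v', v)]"


section \<open>The algorithm\<close>

text \<open>
  During label setting, a state consists of the temporary and the permanent labels.
\<close>

datatype 'v lsa_state =
    Labels "('v \<times> 'v label) set" "('v \<times> 'v label) set"
  | Output "('v \<times> 'v) list"

definition initial_state :: "'v \<Rightarrow> nat \<Rightarrow> 'v lsa_state" where
  "initial_state s \<Gamma> = Labels {(s, Label (0\<^sub>v (\<Gamma> + 1)) None)} {}"

text \<open>
  Processing one outgoing arc of the node of the selected label \<open>l'\<close>, where \<open>P\<close> is the set of
  permanent and \<open>T\<close> the set of temporary labels.
\<close>

definition process_arc ::
    "('v \<times> 'v \<Rightarrow> real) \<Rightarrow> ('v \<times> 'v \<Rightarrow> real) \<Rightarrow> ('v \<times> 'v label) set \<Rightarrow> 'v label \<Rightarrow>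
     'v \<times> 'v \<Rightarrow> ('v \<times> 'v label) set \<Rightarrow> ('v \<times> 'v label) set" where
  "process_arc chat \<delta> P l' e T =
     (let v' = fst e; v = snd e;
          z = extend_cost (label_cost l') (chat e) (\<delta> e)
      in if \<exists>l. (v, l) \<in> T \<union> P \<and> (dominates (label_cost l) z \<or> label_cost l = z) then T
         else insert (v, Label z (Some (v', l'))) (T - {(v, l) | l. dominates z (label_cost l)}))"

text \<open>
  The algorithm leaves open how ties are broken and in which order the outgoing arcs of a node are
  processed, so it is a transition relation: \<open>iterate\<close> is one iteration of the while loop
  and \<open>finish\<close> comprises the two steps after the loop.
\<close>

inductive lsa_step ::
    "'v pair_pre_digraph \<Rightarrow> 'v \<Rightarrow> ('v \<times> 'v \<Rightarrow> real) \<Rightarrow> ('v \<times> 'v \<Rightarrow> real) \<Rightarrow>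
     'v lsa_state \<Rightarrow> 'v lsa_state \<Rightarrow> bool"
  for G t chat \<delta> where
  iterate:
    "\<lbrakk> is_arg_min (\<lambda>(v, l). aggregate (label_cost l)) (\<lambda>x. x \<in> T) (v', l');
       P' = insert (v', l') P;
       distinct es; set es = out_arcs (with_proj G) v';
       T' = fold (process_arc chat \<delta> P' l') es (T - {(v', l')}) \<rbrakk>
     \<Longrightarrow> lsa_step G t chat \<delta> (Labels T P) (Labels T' P')"
| finish:
    "is_arg_min (\<lambda>l. aggregate (label_cost l)) (\<lambda>l. (t, l) \<in> P) l
     \<Longrightarrow> lsa_step G t chat \<delta> (Labels {} P) (Output (label_path t l))"

end

theory Submission
  imports Defs
begin

text \<open>
  The cost vector of a path keeps its total nominal cost in component \<open>0\<close> and its \<open>\<Gamma>\<close> largest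
  interval lengths, in decreasing order and padded with zeros, in the components \<open>1, \<dots>, \<Gamma>\<close>;
  the update \<open>\<oplus>\<close> is insertion into such a truncated sorted list. In the worst case of the uncertainty
  set the \<open>\<Gamma>\<close> arcs of a path with the largest interval lengths, or all of its arcs if there are
  fewer, are at their upper bounds, so the aggregate cost of the vector is the robust cost of the path (\<open>robust_cost_eq_aggregate\<close>).
  The robust problem thereby becomes a shortest path problem with vector costs in which \<open>\<oplus>\<close> is
  monotone (\<open>extend_cost_mono\<close>) and never decreases a component (\<open>extend_cost_increasing\<close>).

  Dominated labels may then be discarded. Whenever a label disappears or is not created, another label
  at the same node has a cost vector that is componentwise at most as large. Therefore every extension
  of a permanent label along an arc remains covered by some label. Once no temporary labels are left,
  induction along a path from \<open>s\<close> to \<open>t\<close>, with monotonicity in each step, yields a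
  permanent label at \<open>t\<close> that is at least as good as that path (\<open>covering_awalks\<close>). A
  permanent label of minimal aggregate cost at \<open>t\<close> is consequently at least as good as every path.

  The output must also be a simple path, and the loop must stop. Both follow from the fact that a
  label is no cheaper than the labels along its own path: if an arc leads back to a node of the path, then a
  permanent label at that node covers the extended cost, and no new label is created
  (\<open>sound_process_arc\<close>). All labels thus represent simple paths, of which there are only
  finitely many, and every iteration adds a new one of them to the permanent labels.
\<close>

section \<open>The cost update\<close>

definition decreasing_tail :: "real vec \<Rightarrow> bool" where
  "decreasing_tail z \<longleftrightarrow> (\<forall>i j. 1 \<le> i \<longrightarrow> i \<le> j \<longrightarrow> j < dim_vec z \<longrightarrow> z $ j \<le> z $ i)"

lemma decreasing_tailD:
  "decreasing_tail z \<Longrightarrow> 1 \<le> i \<Longrightarrow> i \<le> j \<Longrightarrow> j < dim_vec z \<Longrightarrow> z $ j \<le> z $ i"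
  by (simp add: decreasing_tail_def)

lemma dim_extend_cost [simp]: "dim_vec (extend_cost z a d) = dim_vec z"
  by (simp add: extend_cost_def Let_def)

text \<open>
  Replacing the case distinction on the insertion point by a minimum and a maximum makes
  monotonicity in \<open>z\<close> visible component by component.
\<close>

lemma extend_cost_index:
  assumes z: "decreasing_tail z" and j: "j < dim_vec z"
  shows "extend_cost z a d $ j =
    (if j = 0 then z $ 0 + a else if j = 1 then max (z $ 1) d else max (z $ j) (min (z $ (j - 1)) d))"
proof (cases "\<forall>k\<in>{1..<dim_vec z}. d \<le> z $ k")
  case True
  then have "j \<noteq> 0 \<Longrightarrow> d \<le> z $ j" using j by auto
  then have "j \<noteq> 0 \<Longrightarrow> max (z $ j) d = z $ j" "j \<noteq> 0 \<Longrightarrow> max (z $ j) (min (z $ (j - 1)) d) = z $ j"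
    by auto
  then show ?thesis using True j by (auto simp: extend_cost_def Let_def)
next
  case False
  define i where "i = (LEAST i. i \<in> {1..<dim_vec z} \<and> d > z $ i)"
  have "\<exists>i. i \<in> {1..<dim_vec z} \<and> d > z $ i" using False by auto
  then have "i \<in> {1..<dim_vec z} \<and> d > z $ i" unfolding i_def by (rule LeastI_ex)
  then have i: "1 \<le> i" "i < dim_vec z" "z $ i < d" by auto
  have before: "d \<le> z $ k" if "1 \<le> k" "k < i" for k
    using not_less_Least[of k "\<lambda>i. i \<in> {1..<dim_vec z} \<and> d > z $ i"] that i(2)
    unfolding i_def by force
  have lhs: "extend_cost z a d $ j = (if j = 0 then z $ 0 + a else if j < i then z $ j
      else if j = i then d else z $ (j - 1))"
    using False j unfolding extend_cost_def Let_def i_def[symmetric] by auto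
  consider "j = 0" | "1 \<le> j" "j < i" | "j = i" | "i < j" by linarith
  then show ?thesis
  proof cases
    case 2
    then show ?thesis using before[of j] by (auto simp: lhs)
  next
    case 3
    then have "extend_cost z a d $ j = d" using lhs 3 i by simp
    then show ?thesis using 3 before[of "j - 1"] i by auto
  next
    case 4
    then have "z $ (j - 1) \<le> z $ i" "z $ j \<le> z $ (j - 1)"
      using i j by (auto intro!: decreasing_tailD[OF z])
    then show ?thesis using 4 i by (auto simp: lhs)
  qed (use lhs in simp)
qed

lemma decreasing_tail_extend_cost:
  assumes z: "decreasing_tail z"
  shows "decreasing_tail (extend_cost z a d)"
  unfolding decreasing_tail_def
proof (intro allI impI)
  fix i j :: nat
  assume "1 \<le> i" "i \<le> j" "j < dim_vec (extend_cost z a d)"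
  from this(2,1,3) show "extend_cost z a d $ j \<le> extend_cost z a d $ i"
  proof (induction j rule: dec_induct)
    case (step k)
    then have "extend_cost z a d $ Suc k \<le> extend_cost z a d $ k"
      using decreasing_tailD[OF z, of k "Suc k"] decreasing_tailD[OF z, of "k - 1" k]
      by (auto simp: extend_cost_index[OF z])
    then show ?case using step by simp
  qed simp
qed

lemma extend_cost_mono:
  assumes "decreasing_tail y" "decreasing_tail z" "y \<le> z"
  shows "extend_cost y a d \<le> extend_cost z a d"
proof -
  have dim: "dim_vec y = dim_vec z" and le: "\<And>i. i < dim_vec z \<Longrightarrow> y $ i \<le> z $ i"
    using assms(3) by (auto simp: less_eq_vec_def)
  have "extend_cost y a d $ i \<le> extend_cost z a d $ i" if "i < dim_vec z" for i
  proof -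
    have "max (y $ i) d \<le> max (z $ i) d"
      "max (y $ i) (min (y $ (i - 1)) d) \<le> max (z $ i) (min (z $ (i - 1)) d)"
      using that by (auto intro!: max.mono min.mono le simp del: max.bounded_iff)
    then show ?thesis
      using le[OF that] that dim
      by (auto simp: extend_cost_index[OF assms(1)] extend_cost_index[OF assms(2)] simp del: max.bounded_iff)
  qed
  then show ?thesis using dim by (simp add: less_eq_vec_def)
qed

lemma extend_cost_increasing:
  assumes "decreasing_tail z" "0 \<le> a"
  shows "z \<le> extend_cost z a d"
  using assms by (auto simp: less_eq_vec_def extend_cost_index)

text \<open>
  The \<open>k + 1\<close> largest elements after an insertion either do not include \<open>d\<close>, or consist of \<open>d\<close>
  and the \<open>k\<close> largest of the old elements. This recursion describes the best choice
  of at most \<open>k + 1\<close> elements, which links the cost vectors to the uncertainty set.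
\<close>

lemma sum_tail_extend_cost:
  assumes z: "decreasing_tail z" and k: "Suc k < dim_vec z"
  shows "(\<Sum>i=1..Suc k. extend_cost z a d $ i) = max (\<Sum>i=1..Suc k. z $ i) ((\<Sum>i=1..k. z $ i) + d)"
  using k
proof (induction k)
  case 0
  then show ?case by (simp add: extend_cost_index[OF z])
next
  case (Suc k)
  have "z $ Suc (Suc k) \<le> z $ Suc k" using Suc.prems by (intro decreasing_tailD[OF z]) auto
  moreover have "extend_cost z a d $ Suc (Suc k) = max (z $ Suc (Suc k)) (min (z $ Suc k) d)"
    using Suc.prems by (simp add: extend_cost_index[OF z])
  ultimately show ?case using Suc by (auto simp: max_def min_def split: if_splits)
qed

lemma aggregate_split:
  "dim_vec z = Suc n \<Longrightarrow> aggregate z = z $ 0 + (\<Sum>i=1..n. z $ i)"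
  unfolding aggregate_def
  by (simp only: lessThan_Suc_atMost atLeast0AtMost[symmetric] sum.atLeast_Suc_atMost[of 0 n] One_nat_def)

lemma dominates_or_eq: "dominates y z \<or> y = z \<longleftrightarrow> y \<le> z"
  by (auto simp: dominates_def)


section \<open>Labels of paths\<close>

locale lsa_instance = pair_fin_digraph G
  for G :: "'v pair_pre_digraph" +
  fixes s t :: 'v and chat \<delta> :: "'v \<times> 'v \<Rightarrow> real" and \<Gamma> :: nat
  assumes source: "s \<in> pverts G"
    and target_reachable: "st_paths G s t \<noteq> {}"
    and chat_nonneg: "e \<in> parcs G \<Longrightarrow> 0 \<le> chat e"
    and delta_nonneg: "e \<in> parcs G \<Longrightarrow> 0 \<le> \<delta> e"
begin

lemma awalk_snoc_iff: "awalk u (p @ [e]) v \<longleftrightarrow> awalk u p (fst e) \<and> e \<in> parcs G \<and> snd e = v"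
proof -
  have "awalk u p (fst e) \<Longrightarrow> last (pawalk_verts u p) = fst e" by auto
  then show ?thesis by (auto simp: awalk_simps arc_snd_in_verts)
qed

lemma pawalk_verts_snoc:
  "awalk u p (fst e) \<Longrightarrow> pawalk_verts u (p @ [e]) = pawalk_verts u p @ [snd e]"
  by (induction p arbitrary: u) (auto simp: awalk_simps)

lemma apath_snocI:
  "apath u p (fst e) \<Longrightarrow> e \<in> parcs G \<Longrightarrow> snd e \<notin> set (pawalk_verts u p) \<Longrightarrow> apath u (p @ [e]) (snd e)"
  by (auto simp: apath_def awalk_snoc_iff pawalk_verts_snoc simp del: awalk_append_iff)

text \<open>
  In a run of the algorithm a path determines the label that represents it, including all predecessor
  labels. Making this label a function of the path reduces statements on labels to statements on paths.
\<close>

definition path_label :: "('v \<times> 'v) list \<Rightarrow> 'v label" where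
  "path_label p =
     foldl (\<lambda>l e. Label (extend_cost (label_cost l) (chat e) (\<delta> e)) (Some (fst e, l)))
       (Label (0\<^sub>v (\<Gamma> + 1)) None) p"

abbreviation path_cost :: "('v \<times> 'v) list \<Rightarrow> real vec" where
  "path_cost p \<equiv> label_cost (path_label p)"

lemma path_label_Nil [simp]: "path_label [] = Label (0\<^sub>v (\<Gamma> + 1)) None"
  by (simp add: path_label_def)

lemma path_label_snoc [simp]:
  "path_label (p @ [e]) = Label (extend_cost (path_cost p) (chat e) (\<delta> e)) (Some (fst e, path_label p))"
  by (simp add: path_label_def)

lemma dim_path_cost [simp]: "dim_vec (path_cost p) = Suc \<Gamma>"
  by (induction p rule: rev_induct) auto

lemma decreasing_tail_path_cost: "decreasing_tail (path_cost p)"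
  by (induction p rule: rev_induct)
    (simp_all add: decreasing_tail_extend_cost, simp add: decreasing_tail_def)

lemma label_path_path_label: "awalk u p v \<Longrightarrow> label_path v (path_label p) = p"
  by (induction p arbitrary: v rule: rev_induct) (auto simp: awalk_snoc_iff simp del: awalk_append_iff)

section \<open>Robust costs\<close>

lemma path_cost_0: "path_cost p $ 0 = (\<Sum>e\<leftarrow>p. chat e)"
  by (induction p rule: rev_induct) (auto simp: extend_cost_index[OF decreasing_tail_path_cost])

text \<open>
  The partial sums of the tail of a path cost are the maximal values of \<open>sum \<delta> A\<close> over the sets
  \<open>A\<close> of at most \<open>k\<close> arcs of the path: an upper bound here, attainment in the next lemma. Although only
  \<open>k = \<Gamma>\<close> matters in the end, the recursion for the partial sums leads from \<open>k + 1\<close> to \<open>k\<close>.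
\<close>

lemma sum_delta_le_path_cost:
  "distinct p \<Longrightarrow> A \<subseteq> set p \<Longrightarrow> card A \<le> k \<Longrightarrow> k \<le> \<Gamma> \<Longrightarrow> sum \<delta> A \<le> (\<Sum>i=1..k. path_cost p $ i)"
proof (induction p arbitrary: A k rule: rev_induct)
  case (snoc e p)
  have fin: "finite A" using snoc.prems(2) by (rule finite_subset) simp
  show ?case
  proof (cases k)
    case 0
    then show ?thesis using snoc.prems fin by simp
  next
    case (Suc j)
    then have "Suc j < dim_vec (path_cost p)" using snoc.prems by simp
    note sums = sum_tail_extend_cost[OF decreasing_tail_path_cost this, of "chat e" "\<delta> e"]
    show ?thesis
    proof (cases "e \<in> A")
      case True
      have "sum \<delta> (A - {e}) \<le> (\<Sum>i=1..j. path_cost p $ i)"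
        using snoc.prems True fin Suc by (intro snoc.IH) auto
      then show ?thesis using sums True fin by (simp add: Suc sum.remove del: sum.cl_ivl_Suc)
    next
      case False
      then have "sum \<delta> A \<le> (\<Sum>i=1..Suc j. path_cost p $ i)"
        using snoc.prems Suc by (intro snoc.IH) auto
      then show ?thesis using sums by (simp add: Suc del: sum.cl_ivl_Suc)
    qed
  qed
qed simp

lemma ex_sum_delta_eq_path_cost:
  "distinct p \<Longrightarrow> k \<le> \<Gamma> \<Longrightarrow> \<exists>A\<subseteq>set p. card A \<le> k \<and> sum \<delta> A = (\<Sum>i=1..k. path_cost p $ i)"
proof (induction p arbitrary: k rule: rev_induct)
  case Nil
  then show ?case by (intro exI[of _ "{}"]) auto
next
  case (snoc e p)
  show ?case
  proof (cases k)
    case 0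
    then show ?thesis by (intro exI[of _ "{}"]) auto
  next
    case (Suc j)
    then have "Suc j < dim_vec (path_cost p)" using snoc.prems by simp
    note sums = sum_tail_extend_cost[OF decreasing_tail_path_cost this, of "chat e" "\<delta> e"]
    obtain A where A: "A \<subseteq> set p" "card A \<le> Suc j" "sum \<delta> A = (\<Sum>i=1..Suc j. path_cost p $ i)"
      using snoc.IH[of "Suc j"] snoc.prems Suc by auto
    obtain B where B: "B \<subseteq> set p" "card B \<le> j" "sum \<delta> B = (\<Sum>i=1..j. path_cost p $ i)"
      using snoc.IH[of j] snoc.prems Suc by auto
    have fin: "finite B" using B(1) by (rule finite_subset) simp
    have "e \<notin> B" using B(1) snoc.prems by auto
    then have eB: "card (insert e B) \<le> Suc j" "sum \<delta> (insert e B) = (\<Sum>i=1..j. path_cost p $ i) + \<delta> e"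
      using fin B by auto
    show ?thesis
    proof (cases "(\<Sum>i=1..j. path_cost p $ i) + \<delta> e \<le> (\<Sum>i=1..Suc j. path_cost p $ i)")
      case True
      then show ?thesis using sums A by (intro exI[of _ A]) (auto simp: Suc simp del: sum.cl_ivl_Suc)
    next
      case False
      then show ?thesis
        using sums eB B(1) by (intro exI[of _ "insert e B"]) (auto simp: Suc simp del: sum.cl_ivl_Suc)
    qed
  qed
qed

lemma robust_cost_eq_aggregate:
  assumes q: "apath s q v"
  shows "robust_cost G chat \<delta> \<Gamma> q = aggregate (path_cost q)"
proof -
  have dist: "distinct q" using q by (auto simp: apath_def intro: distinct_verts_imp_distinct)
  have arcs: "set q \<subseteq> parcs G" using q by (auto simp: apath_def awalk_def)
  have agg: "aggregate (path_cost q) = sum chat (set q) + (\<Sum>i=1..\<Gamma>. path_cost q $ i)"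
    using dist by (simp add: aggregate_split path_cost_0 sum_list_distinct_conv_sum_set)
  show ?thesis
    unfolding robust_cost_def
  proof (rule Greatest_equality)
    obtain A where A: "A \<subseteq> set q" "card A \<le> \<Gamma>" "sum \<delta> A = (\<Sum>i=1..\<Gamma>. path_cost q $ i)"
      using ex_sum_delta_eq_path_cost[OF dist] by blast
    \<comment> \<open>The worst scenario raises exactly the arcs of a best choice \<open>A\<close> to their upper bounds.\<close>
    define c where "c = (\<lambda>e\<in>parcs G. chat e + (if e \<in> A then \<delta> e else 0))"
    have "finite A" using A(1) by (rule finite_subset) simp
    then have "card {e \<in> parcs G. chat e < c e} \<le> card A"
      by (rule card_mono) (auto simp: c_def split: if_splits)
    then have "c \<in> uncertainty_set G chat \<delta> \<Gamma>"
      using A(2) delta_nonneg by (auto simp: uncertainty_set_def c_def)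
    moreover have "(\<Sum>e\<in>set q. c e) = sum chat (set q) + (\<Sum>e\<in>set q. if e \<in> A then \<delta> e else 0)"
      unfolding sum.distrib[symmetric] using arcs by (intro sum.cong) (auto simp: c_def)
    moreover have "(\<Sum>e\<in>set q. if e \<in> A then \<delta> e else 0) = sum \<delta> A"
      using A(1) by (simp add: sum.inter_restrict[symmetric] Int_absorb1)
    ultimately show "\<exists>c\<in>uncertainty_set G chat \<delta> \<Gamma>. aggregate (path_cost q) = (\<Sum>e\<in>set q. c e)"
      using agg A(3) by (intro bexI[of _ c]) auto
  next
    fix y
    assume "\<exists>c\<in>uncertainty_set G chat \<delta> \<Gamma>. y = (\<Sum>e\<in>set q. c e)"
    then obtain c where c: "c \<in> uncertainty_set G chat \<delta> \<Gamma>" and y: "y = (\<Sum>e\<in>set q. c e)" by blast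
    have c_le: "c e \<le> chat e + \<delta> e" if "e \<in> parcs G" for e
      using c that by (auto simp: uncertainty_set_def PiE_iff)
    define A where "A = {e \<in> set q. chat e < c e}"
    have "card A \<le> card {e \<in> parcs G. chat e < c e}"
      using arcs pair_finite_arcs by (intro card_mono) (auto simp: A_def)
    then have "card A \<le> \<Gamma>" using c by (auto simp: uncertainty_set_def)
    then have "sum \<delta> A \<le> (\<Sum>i=1..\<Gamma>. path_cost q $ i)"
      by (intro sum_delta_le_path_cost[OF dist]) (auto simp: A_def)
    moreover have "y \<le> (\<Sum>e\<in>set q. chat e + (if e \<in> A then \<delta> e else 0))"
      unfolding y using arcs c_le by (intro sum_mono) (auto simp: A_def)
    moreover have "\<dots> = sum chat (set q) + sum \<delta> (set q \<inter> A)"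
      by (simp add: sum.distrib sum.inter_restrict)
    moreover have "set q \<inter> A = A" by (auto simp: A_def)
    ultimately show "y \<le> aggregate (path_cost q)" using agg by simp
  qed
qed

section \<open>Invariants of the label setting phase\<close>

definition covered :: "('v \<times> 'v label) set \<Rightarrow> 'v \<Rightarrow> real vec \<Rightarrow> bool" where
  "covered X v z \<longleftrightarrow> (\<exists>l. (v, l) \<in> X \<and> label_cost l \<le> z)"

lemma covered_mono: "covered X v z \<Longrightarrow> X \<subseteq> Y \<Longrightarrow> z \<le> z' \<Longrightarrow> covered Y v z'"
  unfolding covered_def by (meson order_trans subsetD)

lemma process_arc_eq:
  "process_arc chat \<delta> P l' e T =
    (let z = extend_cost (label_cost l') (chat e) (\<delta> e) in
     if covered (T \<union> P) (snd e) z then T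
     else insert (snd e, Label z (Some (fst e, l'))) (T - {(snd e, l) | l. dominates z (label_cost l)}))"
  by (simp add: process_arc_def covered_def dominates_or_eq Let_def)

lemma covered_superset: "covered X v z \<Longrightarrow> X \<subseteq> Y \<Longrightarrow> covered Y v z"
  by (auto simp: covered_def)

text \<open>
  The last conjunct is what keeps paths simple: an extension of \<open>l\<close> to a node \<open>u\<close> that its path has already
  visited costs at least as much as \<open>l\<close>, hence is covered at \<open>u\<close>.
  Since permanent labels are never deleted, this property persists.
\<close>

definition simple_path_label :: "('v \<times> 'v label) set \<Rightarrow> 'v \<Rightarrow> 'v label \<Rightarrow> bool" where
  "simple_path_label P v l \<longleftrightarrow> (\<exists>p. apath s p v \<and> l = path_label p \<and>
     (\<forall>u\<in>set (pawalk_verts s p) - {v}. covered P u (label_cost l)))"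

lemma simple_path_label_mono: "simple_path_label P v l \<Longrightarrow> P \<subseteq> P' \<Longrightarrow> simple_path_label P' v l"
  unfolding simple_path_label_def using covered_superset by blast

definition sound :: "('v \<times> 'v label) set \<Rightarrow> ('v \<times> 'v label) set \<Rightarrow> bool" where
  "sound T P \<longleftrightarrow> T \<inter> P = {} \<and> (\<forall>v l. (v, l) \<in> T \<union> P \<longrightarrow> simple_path_label P v l)"

definition covering :: "('v \<times> 'v label) set \<Rightarrow> ('v \<times> 'v label) set \<Rightarrow> bool" where
  "covering T P \<longleftrightarrow> covered (T \<union> P) s (0\<^sub>v (\<Gamma> + 1)) \<and>
     (\<forall>v l e. (v, l) \<in> P \<longrightarrow> e \<in> out_arcs G v \<longrightarrow>
        covered (T \<union> P) (snd e) (extend_cost (label_cost l) (chat e) (\<delta> e)))"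

lemma soundE:
  assumes "sound T P" "(v, l) \<in> T \<union> P"
  obtains p where "apath s p v" "l = path_label p"
    "\<And>u. u \<in> set (pawalk_verts s p) \<Longrightarrow> u \<noteq> v \<Longrightarrow> covered P u (label_cost l)"
  using assms unfolding sound_def simple_path_label_def by fast

lemma sound_finite:
  assumes "sound T P"
  shows "T \<union> P \<subseteq> (\<lambda>(u, p, v). (v, path_label p)) ` {(u, p, v). apath u p v}"
    and "finite T" and "finite P"
proof -
  show sub: "T \<union> P \<subseteq> (\<lambda>(u, p, v). (v, path_label p)) ` {(u, p, v). apath u p v}"
  proof
    fix x
    assume x: "x \<in> T \<union> P"
    obtain v l where "x = (v, l)" by (cases x)
    with soundE[OF assms, of v l] x obtain p where "apath s p v" "x = (v, path_label p)" by blast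
    then show "x \<in> (\<lambda>(u, p, v). (v, path_label p)) ` {(u, p, v). apath u p v}" by force
  qed
  have "finite (T \<union> P)" by (rule finite_subset[OF sub]) (intro finite_imageI apaths_finite_triple)
  then show "finite T" "finite P" by auto
qed

lemma sound_subset: "sound T P \<Longrightarrow> T' \<subseteq> T \<Longrightarrow> sound T' P"
  unfolding sound_def by blast

text \<open>
  If the new arc led back to the path \<open>p\<close> of the label \<open>l'\<close>, then the permanent label covering \<open>l'\<close> at its
  head would also cover the increased cost, and no label would be created.
\<close>

lemma sound_process_arc:
  assumes sound: "sound T P" and l': "(fst e, l') \<in> P" and e: "e \<in> parcs G"
  shows "sound (process_arc chat \<delta> P l' e T) P"
proof -
  define z where "z = extend_cost (label_cost l') (chat e) (\<delta> e)"
  define l where "l = Label z (Some (fst e, l'))"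
  show ?thesis
  proof (cases "covered (T \<union> P) (snd e) z")
    case True
    then show ?thesis using sound by (simp add: process_arc_eq z_def)
  next
    case False
    obtain p where p: "apath s p (fst e)" "l' = path_label p"
      and verts: "\<And>u. u \<in> set (pawalk_verts s p) \<Longrightarrow> u \<noteq> fst e \<Longrightarrow> covered P u (label_cost l')"
      using soundE[OF sound, of "fst e" l'] l' by blast
    have "label_cost l' \<le> z"
      using chat_nonneg[OF e] unfolding z_def p(2)
      by (intro extend_cost_increasing decreasing_tail_path_cost)
    then have cov: "covered P u z" if "u \<in> set (pawalk_verts s p)" for u
      using that verts[of u] l' covered_mono[of P u "label_cost l'" P z]
      by (cases "u = fst e") (auto simp: covered_def)
    have "snd e \<notin> set (pawalk_verts s p)"
      using False cov covered_mono[of P "snd e" z "T \<union> P" z] by blast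
    then have path: "apath s (p @ [e]) (snd e)" using p e by (intro apath_snocI)
    have label: "l = path_label (p @ [e])" by (simp add: l_def z_def p(2))
    \<comment> \<open>A fresh label has a cost that no label at its node has; hence it differs from all of them.\<close>
    have "(snd e, l) \<notin> P" using False by (auto simp: covered_def l_def)
    moreover have "simple_path_label P (snd e) l"
      unfolding simple_path_label_def
    proof (intro exI conjI)
      show "\<forall>u\<in>set (pawalk_verts s (p @ [e])) - {snd e}. covered P u (label_cost l)"
        using cov p(1) by (auto simp: pawalk_verts_snoc apath_def l_def)
    qed fact+
    ultimately have "sound (insert (snd e, l) T) P"
      using sound unfolding sound_def by auto
    moreover have "process_arc chat \<delta> P l' e T \<subseteq> insert (snd e, l) T"
      using False by (auto simp: process_arc_eq z_def l_def Let_def)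
    ultimately show ?thesis by (rule sound_subset)
  qed
qed

lemma sound_fold_process_arc:
  assumes "sound T P" "(v', l') \<in> P" "set es \<subseteq> out_arcs G v'"
  shows "sound (fold (process_arc chat \<delta> P l') es T) P"
  using assms
proof (induction es arbitrary: T)
  case (Cons e es)
  then have "fst e = v'" "e \<in> parcs G" by auto
  then have "sound (process_arc chat \<delta> P l' e T) P"
    using Cons.prems by (intro sound_process_arc) auto
  then show ?case using Cons by simp
qed simp

text \<open>
  A deleted label is dominated by the label inserted in its place, which inherits what it covered.
\<close>

lemma covered_process_arc:
  assumes "covered (T \<union> P) v z"
  shows "covered (process_arc chat \<delta> P l' e T \<union> P) v z"
proof -
  obtain l where l: "(v, l) \<in> T \<union> P" "label_cost l \<le> z" using assms by (auto simp: covered_def)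
  define z' where "z' = extend_cost (label_cost l') (chat e) (\<delta> e)"
  show ?thesis
  proof (cases "(v, l) \<in> process_arc chat \<delta> P l' e T \<union> P")
    case True
    then show ?thesis using l by (auto simp: covered_def)
  next
    case False
    then have "v = snd e" "dominates z' (label_cost l)"
      and ins: "(v, Label z' (Some (fst e, l'))) \<in> process_arc chat \<delta> P l' e T"
      using l(1) by (auto simp: process_arc_eq z'_def Let_def split: if_splits)
    then have "z' \<le> z" using l(2) by (auto simp: dominates_def)
    then show ?thesis using ins unfolding covered_def by force
  qed
qed

lemma covered_process_arc_self:
  "covered (process_arc chat \<delta> P l' e T \<union> P) (snd e) (extend_cost (label_cost l') (chat e) (\<delta> e))"
  by (auto simp: process_arc_eq Let_def) (auto simp: covered_def)

lemma covered_fold_process_arc: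
  "covered (T \<union> P) v z \<Longrightarrow> covered (fold (process_arc chat \<delta> P l') es T \<union> P) v z"
  by (induction es arbitrary: T) (auto intro: covered_process_arc)

lemma covered_fold_process_arc_self:
  "e \<in> set es \<Longrightarrow> covered (fold (process_arc chat \<delta> P l') es T \<union> P) (snd e)
     (extend_cost (label_cost l') (chat e) (\<delta> e))"
  by (induction es arbitrary: T) (auto intro: covered_fold_process_arc covered_process_arc_self)

lemma sound_iterate:
  assumes sound: "sound T P" and l': "(v', l') \<in> T" and es: "set es = out_arcs G v'"
  shows "sound (fold (process_arc chat \<delta> (insert (v', l') P) l') es (T - {(v', l')})) (insert (v', l') P)"
proof (rule sound_fold_process_arc)
  have un: "(T - {(v', l')}) \<union> insert (v', l') P = T \<union> P" using l' by auto
  show "sound (T - {(v', l')}) (insert (v', l') P)"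
    using sound simple_path_label_mono[of P _ _ "insert (v', l') P"] l' unfolding sound_def un by blast
qed (use es in auto)

lemma covering_iterate:
  assumes covering: "covering T P" and l': "(v', l') \<in> T" and es: "set es = out_arcs G v'"
  shows "covering (fold (process_arc chat \<delta> (insert (v', l') P) l') es (T - {(v', l')})) (insert (v', l') P)"
proof -
  have un: "(T - {(v', l')}) \<union> insert (v', l') P = T \<union> P" using l' by auto
  have keep: "covered (fold (process_arc chat \<delta> (insert (v', l') P) l') es (T - {(v', l')})
      \<union> insert (v', l') P) v z" if "covered (T \<union> P) v z" for v z
    using that by (intro covered_fold_process_arc) (simp only: un)
  show ?thesis
    unfolding covering_def
  proof (intro conjI allI impI, goal_cases)
    case 1
    then show ?case using covering unfolding covering_def by (intro keep) blast
  next
    case (2 v l e)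
    show ?case
    proof (cases "(v, l) = (v', l')")
      case True
      then show ?thesis using 2 es covered_fold_process_arc_self[of e] by (simp del: Un_insert_right)
    next
      case False
      then show ?thesis using 2 covering unfolding covering_def by (intro keep) blast
    qed
  qed
qed

text \<open>
  Bellman's principle for the vector costs: extending a label that covers a prefix of the walk covers
  the longer prefix by monotonicity of the update.
\<close>

lemma covering_awalks:
  assumes "sound {} P" "covering {} P"
  shows "awalk s p v \<Longrightarrow> covered P v (path_cost p)"
proof (induction p arbitrary: v rule: rev_induct)
  case Nil
  then have "v = s" by (simp add: awalk_simps)
  then show ?case using assms(2) by (simp add: covering_def)
next
  case (snoc e p)
  then have e: "e \<in> out_arcs G (fst e)" and v: "snd e = v" and "awalk s p (fst e)"
    by (auto simp: awalk_snoc_iff simp del: awalk_append_iff)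
  then obtain l where l: "(fst e, l) \<in> P" "label_cost l \<le> path_cost p"
    using snoc.IH unfolding covered_def by blast
  obtain r where "l = path_label r" using soundE[OF assms(1)] l(1) by blast
  then have "extend_cost (label_cost l) (chat e) (\<delta> e) \<le> path_cost (p @ [e])"
    using l(2) by (auto intro: extend_cost_mono decreasing_tail_path_cost)
  moreover have "covered ({} \<union> P) (snd e) (extend_cost (label_cost l) (chat e) (\<delta> e))"
    using assms(2) l(1) e unfolding covering_def by blast
  ultimately show ?case using v by (auto elim: covered_mono)
qed

section \<open>Correctness and termination\<close>

fun lsa_invariant :: "'v lsa_state \<Rightarrow> bool" where
  "lsa_invariant (Labels T P) \<longleftrightarrow> sound T P \<and> covering T P"
| "lsa_invariant (Output q) \<longleftrightarrow> optimal_path G s t chat \<delta> \<Gamma> q"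

lemma aggregate_mono: "y \<le> z \<Longrightarrow> aggregate y \<le> aggregate z"
  by (auto simp: less_eq_vec_def aggregate_def intro: sum_mono)

lemma lsa_invariant_initial: "lsa_invariant (initial_state s \<Gamma>)"
  using source
  by (auto simp: initial_state_def sound_def simple_path_label_def covering_def covered_def apath_simps intro!: exI[of _ "[]"])

lemma optimal_path_label_path:
  assumes sound: "sound {} P" and covering: "covering {} P"
    and l: "is_arg_min (\<lambda>l. aggregate (label_cost l)) (\<lambda>l. (t, l) \<in> P) l"
  shows "optimal_path G s t chat \<delta> \<Gamma> (label_path t l)"
proof -
  have lP: "(t, l) \<in> P" and min: "\<And>m. (t, m) \<in> P \<Longrightarrow> aggregate (label_cost l) \<le> aggregate (label_cost m)"
    using l by (auto simp: is_arg_min_linorder)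
  obtain p where p: "apath s p t" "l = path_label p"
    using soundE[OF sound, of t l] lP by blast
  then have path: "label_path t l = p" by (auto simp: apath_def label_path_path_label)
  have "robust_cost G chat \<delta> \<Gamma> p \<le> robust_cost G chat \<delta> \<Gamma> q" if q: "apath s q t" for q
  proof -
    have "covered P t (path_cost q)"
      using q by (intro covering_awalks[OF sound covering]) (simp add: apath_def)
    then obtain m where "(t, m) \<in> P" "label_cost m \<le> path_cost q" by (auto simp: covered_def)
    then have "aggregate (path_cost p) \<le> aggregate (path_cost q)"
      using min[of m] aggregate_mono[of "label_cost m" "path_cost q"] p(2) by simp
    then show ?thesis using p q by (simp add: robust_cost_eq_aggregate)
  qed
  then show ?thesis
    using p(1) unfolding path by (simp add: optimal_path_def st_paths_def is_arg_min_linorder)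
qed

lemma lsa_invariant_step: "lsa_step G t chat \<delta> S S' \<Longrightarrow> lsa_invariant S \<Longrightarrow> lsa_invariant S'"
proof (induction rule: lsa_step.induct)
  case (iterate T v' l' P' P es T')
  then have "(v', l') \<in> T" by (simp add: is_arg_min_def)
  then show ?case using iterate by (simp add: sound_iterate covering_iterate)
next
  case (finish P l)
  then show ?case using optimal_path_label_path[of P l] by (simp only: lsa_invariant.simps)
qed

text \<open>
  Disjointness of temporary and permanent labels is what makes the selected label a new permanent one,
  and so bounds the number of iterations by the number of simple paths.
\<close>

lemma lsa_step_card_permanent:
  assumes "lsa_step G t chat \<delta> (Labels T P) (Labels T' P')" "sound T P"
  shows "card P' = Suc (card P)"
  using assms(1)
proof cases
  case (iterate v' l' es)
  then have "(v', l') \<in> T" by (simp add: is_arg_min_def)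
  then have "(v', l') \<notin> P" using assms(2) by (auto simp: sound_def)
  then show ?thesis using sound_finite(3)[OF assms(2)] iterate by simp
qed

lemma not_lsa_step_Output: "\<not> lsa_step G t chat \<delta> (Output q) S"
  by (auto elim: lsa_step.cases)

lemma lsa_terminates:
  "\<nexists>S. S 0 = initial_state s \<Gamma> \<and> (\<forall>i::nat. lsa_step G t chat \<delta> (S i) (S (Suc i)))"
proof
  assume "\<exists>S. S 0 = initial_state s \<Gamma> \<and> (\<forall>i::nat. lsa_step G t chat \<delta> (S i) (S (Suc i)))"
  then obtain S where S0: "S 0 = initial_state s \<Gamma>" and step: "\<And>i. lsa_step G t chat \<delta> (S i) (S (Suc i))"
    by blast
  have inv: "lsa_invariant (S i)" for i
    by (induction i) (use S0 lsa_invariant_initial lsa_invariant_step step in auto)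
  have labels: "\<exists>T P. S i = Labels T P" for i
    using step[of i] by (cases "S i") (auto simp: not_lsa_step_Output)
  define L where "L = (\<lambda>(u, p, v). (v, path_label p)) ` {(u, p, v). apath u p v}"
  have fin: "finite L" unfolding L_def by (intro finite_imageI apaths_finite_triple)
  have "\<exists>T P. S i = Labels T P \<and> i \<le> card P" for i
  proof (induction i)
    case 0
    show ?case using labels by simp
  next
    case (Suc i)
    then obtain T P where S: "S i = Labels T P" "i \<le> card P" by blast
    obtain T' P' where S': "S (Suc i) = Labels T' P'" using labels by blast
    have "card P' = Suc (card P)"
      using lsa_step_card_permanent[of T P T' P'] step[of i] inv[of i] S S' by simp
    then show ?case using S S' by simp
  qed
  then obtain T P where S: "S (Suc (card L)) = Labels T P" "Suc (card L) \<le> card P" by blast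
  have "sound T P" using inv[of "Suc (card L)"] S(1) by simp
  then have "P \<subseteq> L" using sound_finite(1) unfolding L_def by blast
  then have "card P \<le> card L" by (rule card_mono[OF fin])
  then show False using S(2) by simp
qed

lemma lsa_progress:
  assumes "sound T P" "covering T P"
  shows "\<exists>S. lsa_step G t chat \<delta> (Labels T P) S"
proof (cases "T = {}")
  case True
  obtain q where "apath s q t" using target_reachable by (auto simp: st_paths_def)
  then have "covered P t (path_cost q)"
    using assms True by (auto intro: covering_awalks simp: apath_def)
  then obtain l where "(t, l) \<in> P" by (auto simp: covered_def)
  moreover have "finite {l. (t, l) \<in> P}"
    using finite_imageI[OF sound_finite(3)[OF assms(1)], of snd] by (rule rev_finite_subset) force
  ultimately have "\<exists>l. is_arg_min (\<lambda>l. aggregate (label_cost l)) (\<lambda>l. (t, l) \<in> P) l"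
    using ex_is_arg_min_if_finite[of "{l. (t, l) \<in> P}"] by auto
  then show ?thesis using True by (blast intro: lsa_step.finish)
next
  case False
  then obtain v' l' where "is_arg_min (\<lambda>(v, l). aggregate (label_cost l)) (\<lambda>x. x \<in> T) (v', l')"
    using ex_is_arg_min_if_finite[OF sound_finite(2)[OF assms(1)]] by fastforce
  moreover obtain es where "distinct es" "set es = out_arcs G v'"
    using finite_distinct_list[of "out_arcs G v'"] by (auto simp: pair_finite_arcs)
  ultimately show ?thesis by (blast intro: lsa_step.iterate[OF _ refl _ _ refl])
qed

lemma lsa_correct:
  assumes run: "(lsa_step G t chat \<delta>)\<^sup>*\<^sup>* (initial_state s \<Gamma>) S"
    and final: "\<nexists>S'. lsa_step G t chat \<delta> S S'"
  shows "\<exists>q. S = Output q \<and> optimal_path G s t chat \<delta> \<Gamma> q"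
proof -
  have "lsa_invariant S"
    using run by induction (auto intro: lsa_invariant_initial lsa_invariant_step)
  then show ?thesis using final lsa_progress by (cases S) auto
qed

end

theorem corollary34:
  fixes G :: "'v pair_pre_digraph"
    and s t :: 'v
    and chat \<delta> :: "'v \<times> 'v \<Rightarrow> real"
    and \<Gamma> :: nat
  assumes "pair_fin_digraph G"
    and "s \<in> pverts G" and "t \<in> pverts G"
    and "st_paths G s t \<noteq> {}"
    and "\<forall>e\<in>parcs G. 0 \<le> chat e"
    and "\<forall>e\<in>parcs G. 0 \<le> \<delta> e"
    and "\<Gamma> \<le> card (parcs G)"
  shows "(\<nexists>S. S 0 = initial_state s \<Gamma> \<and> (\<forall>i::nat. lsa_step G t chat \<delta> (S i) (S (Suc i)))) \<and>
    (\<forall>S. (lsa_step G t chat \<delta>)\<^sup>*\<^sup>* (initial_state s \<Gamma>) S \<and> (\<nexists>S'. lsa_step G t chat \<delta> S S') \<longrightarrow>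
      (\<exists>q. S = Output q \<and> optimal_path G s t chat \<delta> \<Gamma> q))"
proof -
  interpret pair_fin_digraph G by fact
  interpret lsa_instance G s t chat \<delta> \<Gamma>
    using assms by unfold_locales auto
  show ?thesis using lsa_terminates lsa_correct by blast
qed

end
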